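(* Let $\Sigma$ be a finite alphabet. For every $\varepsilon>0$ and every positive integer $t_0$ there exist $n_0$ and $T_0$ such that every word $S\in\Sigma^n$ with $n\geq n_0$ admits an $\varepsilon$-regular partition $(S_1,\ldots,S_t)$ with $t_0\leq t\leq T_0$. Moreover, one may take $T_0\leq t_0 3^{1/\varepsilon^4}$ and $n_0=t_0\varepsilon^{-\varepsilon^{-4}}$.
   Context: A word of length $n$ over $\Sigma$ is a sequence $S=s_1\ldots s_n$, $s_i\in\Sigma$; $\Sigma^n$ is the set of such words. A factor of $S$ is a block of consecutive letters $S[i,j]=s_is_{i+1}\ldots s_j$. For $q\in\Sigma$, $|S|_q$ is the number of letters of $S$ equal to $q$ and the density is $d_q(S)=|S|_q/|S|$. A word $S$ of length $n$ is $\varepsilon$-regular if for every integer $i$ with $\varepsilon n+1\leq i\leq n-2\varepsilon n+1$ and every $q\in\Sigma$ we have $|d_q(S)-d_q(S[i,i+\varepsilon n-1])|<\varepsilon$. A partition of $S$ is a tuple $(S_1,\ldots,S_t)$ of words with $S=S_1S_2\cdots S_t$ (concatenation). It is an $\varepsilon$-regular partition if the total length of those $S_i$ that are not $\varepsilon$-regular is at most $\varepsilon n$. Divisibility issues are ignored throughout (quantities such as $\varepsilon n$ are treated as integers). *)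

theory Defs
  imports Complex_Main
begin

definition words :: "'a set \<Rightarrow> nat \<Rightarrow> 'a list set" where
  "words A n = {S. set S \<subseteq> A \<and> length S = n}"

text \<open>The factor \<open>S[i,j]\<close>; positions are counted from 1 and both ends are included.\<close>

definition factor :: "'a list \<Rightarrow> nat \<Rightarrow> nat \<Rightarrow> 'a list" where
  "factor S i j = take (j + 1 - i) (drop (i - 1) S)"

definition density :: "'a \<Rightarrow> 'a list \<Rightarrow> real" where
  "density q S = real (count_list S q) / real (length S)"

text \<open>The window length \<open>\<epsilon> n\<close> is rounded up to an integer; the bounds on the starting
  position \<open>i\<close> are inequalities between real numbers.  They force \<open>i \<ge> 1\<close> and
  \<open>i + \<lceil>\<epsilon> n\<rceil> - 1 \<le> n\<close> (for \<open>\<epsilon> > 0\<close> and \<open>n > 0\<close>), so the window always lies inside \<open>S\<close>.\<close>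

definition eps_regular :: "'a set \<Rightarrow> real \<Rightarrow> 'a list \<Rightarrow> bool" where
  "eps_regular A \<epsilon> S \<longleftrightarrow>
     (let n = length S in
      \<forall>i::nat. \<epsilon> * real n + 1 \<le> real i \<and> real i \<le> real n - 2 * \<epsilon> * real n + 1 \<longrightarrow>
        (\<forall>q\<in>A. \<bar>density q S - density q (factor S i (i + nat \<lceil>\<epsilon> * real n\<rceil> - 1))\<bar> < \<epsilon>))"

definition word_partition :: "'a list \<Rightarrow> 'a list list \<Rightarrow> bool" where
  "word_partition S Ss \<longleftrightarrow> concat Ss = S"

definition eps_regular_partition :: "'a set \<Rightarrow> real \<Rightarrow> 'a list \<Rightarrow> 'a list list \<Rightarrow> bool" where
  "eps_regular_partition A \<epsilon> S Ss \<longleftrightarrow>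
     word_partition S Ss \<and>
     real (\<Sum>W\<leftarrow>filter (\<lambda>W. \<not> eps_regular A \<epsilon> W) Ss. length W) \<le> \<epsilon> * real (length S)"

end

theory Submission
  imports Defs
begin

text \<open>
  Energy increment.  The energy of a word \<open>W\<close> is \<open>|W|\<close> times the sum of its squared letter
  densities, and the energy of a partition is the sum over its parts; it lies between 0 and \<open>n\<close>.
  Cutting an irregular word \<open>W\<close> at the ends of a window violating regularity raises the energy by
  at least \<open>\<epsilon>\<^sup>3 |W|\<close>.  Cutting all irregular parts of a partition that is not \<open>\<epsilon>\<close>-regular
  therefore raises the energy by more than \<open>\<epsilon>\<^sup>4 n\<close>, while the number of parts at most triples, and
  this can happen at most \<open>1/\<epsilon>\<^sup>4\<close> times.
\<close>

definition energy :: "'a set \<Rightarrow> 'a list \<Rightarrow> real" where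
  "energy A W = (\<Sum>q\<in>A. (real (count_list W q))\<^sup>2 / real (length W))"

definition irregular_length :: "'a set \<Rightarrow> real \<Rightarrow> 'a list list \<Rightarrow> nat" where
  "irregular_length A \<epsilon> Ss = (\<Sum>W\<leftarrow>filter (\<lambda>W. \<not> eps_regular A \<epsilon> W) Ss. length W)"

lemma energy_Nil [simp]: "energy A [] = 0"
  by (simp add: energy_def)

lemma energy_nonneg: "energy A W \<ge> 0"
  by (auto simp: energy_def intro!: sum_nonneg)

lemma sum_count_list_le:
  assumes "finite A"
  shows "(\<Sum>q\<in>A. count_list W q) \<le> length W"
proof (induction W)
  case (Cons a W)
  have "(\<Sum>q\<in>A. count_list (a # W) q) = (\<Sum>q\<in>A. count_list W q + (if q = a then 1 else 0))"
    by (intro sum.cong) auto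
  also have "\<dots> \<le> length (a # W)"
    using Cons assms by (simp add: sum.distrib sum.delta)
  finally show ?case .
qed simp

lemma energy_le_length:
  assumes "finite A"
  shows "energy A W \<le> real (length W)"
proof -
  have "energy A W \<le> (\<Sum>q\<in>A. real (count_list W q))"
    unfolding energy_def
  proof (rule sum_mono)
    fix q
    have "real (count_list W q) * real (count_list W q) \<le> real (count_list W q) * real (length W)"
      by (intro mult_left_mono) (simp_all add: count_le_length)
    then show "(real (count_list W q))\<^sup>2 / real (length W) \<le> real (count_list W q)"
      by (cases "W = []") (simp_all add: divide_le_eq power2_eq_square)
  qed
  also have "\<dots> \<le> real (length W)"
    using sum_count_list_le[OF assms, of W] by (metis of_nat_le_iff of_nat_sum)
  finally show ?thesis .
qed

lemma sum_energy_le_length: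
  assumes "finite A"
  shows "(\<Sum>W\<leftarrow>Ss. energy A W) \<le> real (length (concat Ss))"
  by (induction Ss) (auto intro: add_mono energy_le_length[OF assms])

text \<open>Jensen's inequality for \<open>x\<^sup>2\<close>, in the form of a tangent at \<open>d\<close> with its error term.\<close>

lemma count_square_tangent:
  "(real (count_list W q))\<^sup>2 / real (length W)
     = 2 * d * real (count_list W q) - d\<^sup>2 * real (length W)
       + real (length W) * (density q W - d)\<^sup>2"
  by (cases "W = []") (simp_all add: density_def field_simps power2_eq_square)

lemma count_square_split:
  fixes X Y Z :: "'a list" and q :: 'a
  defines "W \<equiv> X @ Y @ Z"
  defines "f \<equiv> \<lambda>V. (real (count_list V q))\<^sup>2 / real (length V)"
  shows "f W + real (length Y) * (density q Y - density q W)\<^sup>2 \<le> f X + f Y + f Z"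
proof -
  define d where "d = density q W"
  have W: "f W = 2 * d * real (count_list W q) - d\<^sup>2 * real (length W)"
    unfolding f_def using count_square_tangent[of W q d] by (simp add: d_def)
  have Y: "f Y = 2 * d * real (count_list Y q) - d\<^sup>2 * real (length Y)
      + real (length Y) * (density q Y - d)\<^sup>2"
    unfolding f_def by (rule count_square_tangent)
  have ge: "f V \<ge> 2 * d * real (count_list V q) - d\<^sup>2 * real (length V)" for V
    unfolding f_def using count_square_tangent[of V q d] by simp
  have "count_list W q = count_list X q + count_list Y q + count_list Z q"
    and "length W = length X + length Y + length Z"
    by (simp_all add: W_def)
  then have "f W = (2 * d * real (count_list X q) - d\<^sup>2 * real (length X))
      + (2 * d * real (count_list Y q) - d\<^sup>2 * real (length Y))
      + (2 * d * real (count_list Z q) - d\<^sup>2 * real (length Z))"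
    unfolding W by (simp add: algebra_simps)
  then show ?thesis
    using ge[of X] ge[of Z] Y unfolding d_def by linarith
qed

lemma energy_split:
  assumes "finite A" and "q \<in> A"
  shows "energy A (X @ Y @ Z) + real (length Y) * (density q Y - density q (X @ Y @ Z))\<^sup>2
           \<le> energy A X + energy A Y + energy A Z"
proof -
  let ?e = "\<lambda>r. real (length Y) * (density r Y - density r (X @ Y @ Z))\<^sup>2"
  have "?e q \<le> (\<Sum>r\<in>A. ?e r)"
    using assms by (intro member_le_sum) auto
  moreover have "energy A (X @ Y @ Z) + (\<Sum>r\<in>A. ?e r) \<le> energy A X + energy A Y + energy A Z"
    unfolding energy_def sum.distrib[symmetric] by (intro sum_mono count_square_split)
  ultimately show ?thesis by linarith
qed

lemma irregular_split:
  assumes "\<epsilon> > 0" and "\<not> eps_regular A \<epsilon> W"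
  obtains X Y Z q where "W = X @ Y @ Z" and "q \<in> A"
    and "\<epsilon> * real (length W) \<le> real (length Y)" and "\<epsilon> \<le> \<bar>density q Y - density q W\<bar>"
proof -
  define n where "n = length W"
  define L where "L = nat \<lceil>\<epsilon> * real n\<rceil>"
  obtain i q where i: "\<epsilon> * real n + 1 \<le> real i" "real i \<le> real n - 2 * \<epsilon> * real n + 1"
    and q: "q \<in> A" "\<epsilon> \<le> \<bar>density q W - density q (factor W i (i + L - 1))\<bar>"
    using assms(2) unfolding eps_regular_def Let_def L_def n_def by (metis not_le)
  have nn: "0 \<le> \<epsilon> * real n" using assms(1) by simp
  have i1: "i \<ge> 1" using i(1) nn by linarith
  have L: "\<epsilon> * real n \<le> real L" "real L < \<epsilon> * real n + 1"
    unfolding L_def using nn by linarith+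
  have fits: "i - 1 + L \<le> n"
  proof -
    have "real i + real L < real n + 2" using i(2) L(2) nn by linarith
    then show ?thesis using i1 by linarith
  qed
  define Y where "Y = take L (drop (i - 1) W)"
  have "factor W i (i + L - 1) = Y"
    using i1 by (simp add: factor_def Y_def)
  then have "\<epsilon> \<le> \<bar>density q Y - density q W\<bar>"
    using q(2) by (simp add: abs_minus_commute)
  moreover have "length Y = L" using fits by (simp add: Y_def n_def)
  moreover have "W = take (i - 1) W @ Y @ drop L (drop (i - 1) W)"
    by (simp add: Y_def del: drop_drop)
  ultimately show ?thesis using that q(1) L(1) n_def by metis
qed

text \<open>If \<open>\<epsilon> |W| < 1\<close>, the violating window may be a suffix of \<open>W\<close>; empty pieces are discarded.\<close>

lemma refine_irregular_word:
  assumes "finite A" and "\<epsilon> > 0" and "\<not> eps_regular A \<epsilon> W"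
  obtains Ws where "concat Ws = W" and "[] \<notin> set Ws" and "1 \<le> length Ws" and "length Ws \<le> 3"
    and "energy A W + \<epsilon> ^ 3 * real (length W) \<le> (\<Sum>V\<leftarrow>Ws. energy A V)"
proof -
  obtain X Y Z q where W: "W = X @ Y @ Z" and q: "q \<in> A"
    and Y: "\<epsilon> * real (length W) \<le> real (length Y)" and d: "\<epsilon> \<le> \<bar>density q Y - density q W\<bar>"
    using irregular_split[OF assms(2,3)] .
  define Ws where "Ws = filter (\<lambda>V. V \<noteq> []) [X, Y, Z]"
  have "concat Ws = W" by (simp add: Ws_def W)
  moreover have "[] \<notin> set Ws" by (simp add: Ws_def)
  moreover have "length Ws \<le> 3" by (simp add: Ws_def)
  moreover have "W \<noteq> []" using d assms(2) W by auto
  then have "1 \<le> length Ws" using \<open>concat Ws = W\<close> by (cases Ws) auto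
  moreover have "\<epsilon>\<^sup>2 \<le> (density q Y - density q W)\<^sup>2"
    using d assms(2) by (metis power2_abs power_mono less_imp_le)
  then have "(\<epsilon> * real (length W)) * \<epsilon>\<^sup>2 \<le> real (length Y) * (density q Y - density q W)\<^sup>2"
    using Y by (intro mult_mono) auto
  then have "\<epsilon> ^ 3 * real (length W) \<le> real (length Y) * (density q Y - density q W)\<^sup>2"
    by (simp add: power3_eq_cube power2_eq_square mult_ac)
  with energy_split[OF assms(1) q, of X Y Z]
  have "energy A W + \<epsilon> ^ 3 * real (length W) \<le> energy A X + energy A Y + energy A Z"
    unfolding W by linarith
  then have "energy A W + \<epsilon> ^ 3 * real (length W) \<le> (\<Sum>V\<leftarrow>Ws. energy A V)"
    by (auto simp: Ws_def)
  ultimately show ?thesis using that by blast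
qed

lemma refine_partition:
  assumes "finite A" and "\<epsilon> > 0"
  shows "\<exists>Ts. concat Ts = concat Ss \<and> length Ss \<le> length Ts \<and> length Ts \<le> 3 * length Ss \<and>
           ([] \<notin> set Ss \<longrightarrow> [] \<notin> set Ts) \<and>
           (\<Sum>W\<leftarrow>Ss. energy A W) + \<epsilon> ^ 3 * real (irregular_length A \<epsilon> Ss) \<le> (\<Sum>W\<leftarrow>Ts. energy A W)"
proof (induction Ss)
  case Nil
  then show ?case by (auto simp: irregular_length_def)
next
  case (Cons W Ss)
  then obtain Ts where Ts: "concat Ts = concat Ss" "length Ss \<le> length Ts"
    "length Ts \<le> 3 * length Ss" "[] \<notin> set Ss \<longrightarrow> [] \<notin> set Ts"
    "(\<Sum>W\<leftarrow>Ss. energy A W) + \<epsilon> ^ 3 * real (irregular_length A \<epsilon> Ss) \<le> (\<Sum>W\<leftarrow>Ts. energy A W)"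
    by blast
  show ?case
  proof (cases "eps_regular A \<epsilon> W")
    case True
    then show ?thesis using Ts by (intro exI[of _ "W # Ts"]) (auto simp: irregular_length_def)
  next
    case False
    obtain Ws where "concat Ws = W" "[] \<notin> set Ws" "1 \<le> length Ws" "length Ws \<le> 3"
      "energy A W + \<epsilon> ^ 3 * real (length W) \<le> (\<Sum>V\<leftarrow>Ws. energy A V)"
      using refine_irregular_word[OF assms False] .
    then show ?thesis using Ts False
      by (intro exI[of _ "Ws @ Ts"]) (auto simp: irregular_length_def algebra_simps)
  qed
qed

lemma irregular_partition_refine:
  assumes "finite A" and "\<epsilon> > 0" and "\<not> eps_regular_partition A \<epsilon> (concat Ss) Ss"
  obtains Ts where "concat Ts = concat Ss" and "length Ss \<le> length Ts"
    and "length Ts \<le> 3 * length Ss" and "[] \<notin> set Ss \<Longrightarrow> [] \<notin> set Ts"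
    and "(\<Sum>W\<leftarrow>Ss. energy A W) + \<epsilon> ^ 4 * real (length (concat Ss)) < (\<Sum>W\<leftarrow>Ts. energy A W)"
proof -
  have "\<epsilon> * real (length (concat Ss)) < real (irregular_length A \<epsilon> Ss)"
    using assms(3) by (simp add: eps_regular_partition_def word_partition_def irregular_length_def)
  then have "\<epsilon> ^ 3 * (\<epsilon> * real (length (concat Ss))) < \<epsilon> ^ 3 * real (irregular_length A \<epsilon> Ss)"
    using assms(2) by (intro mult_strict_left_mono) auto
  then have "\<epsilon> ^ 4 * real (length (concat Ss)) < \<epsilon> ^ 3 * real (irregular_length A \<epsilon> Ss)"
    by (simp add: eval_nat_numeral mult_ac)
  with refine_partition[OF assms(1,2), of Ss] that show ?thesis
    by (smt (verit))
qed

lemma regular_or_high_energy: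
  assumes "finite A" and "\<epsilon> > 0"
  shows "\<exists>Ts. concat Ts = concat Ss \<and> length Ss \<le> length Ts \<and> length Ts \<le> length Ss * 3 ^ k \<and>
           ([] \<notin> set Ss \<longrightarrow> [] \<notin> set Ts) \<and>
           (eps_regular_partition A \<epsilon> (concat Ss) Ts \<or>
            real k * (\<epsilon> ^ 4 * real (length (concat Ss))) \<le> (\<Sum>W\<leftarrow>Ts. energy A W))"
proof (induction k)
  case 0
  have "0 \<le> (\<Sum>W\<leftarrow>Ss. energy A W)"
    by (intro sum_list_nonneg) (auto simp: energy_nonneg)
  then show ?case by (intro exI[of _ Ss]) auto
next
  case (Suc k)
  then obtain Ts where Ts: "concat Ts = concat Ss" "length Ss \<le> length Ts"
    "length Ts \<le> length Ss * 3 ^ k" "[] \<notin> set Ss \<longrightarrow> [] \<notin> set Ts"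
    "eps_regular_partition A \<epsilon> (concat Ss) Ts \<or>
     real k * (\<epsilon> ^ 4 * real (length (concat Ss))) \<le> (\<Sum>W\<leftarrow>Ts. energy A W)"
    by blast
  show ?case
  proof (cases "eps_regular_partition A \<epsilon> (concat Ss) Ts")
    case True
    then show ?thesis using Ts by (intro exI[of _ Ts]) auto
  next
    case False
    then have "\<not> eps_regular_partition A \<epsilon> (concat Ts) Ts" by (simp add: Ts(1))
    from irregular_partition_refine[OF assms this]
    obtain Us where Us: "concat Us = concat Ts" "length Ts \<le> length Us"
      "length Us \<le> 3 * length Ts" "[] \<notin> set Ts \<Longrightarrow> [] \<notin> set Us"
      "(\<Sum>W\<leftarrow>Ts. energy A W) + \<epsilon> ^ 4 * real (length (concat Ts)) < (\<Sum>W\<leftarrow>Us. energy A W)"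
      by blast
    have "real (Suc k) * (\<epsilon> ^ 4 * real (length (concat Ss)))
        = real k * (\<epsilon> ^ 4 * real (length (concat Ss))) + \<epsilon> ^ 4 * real (length (concat Ss))"
      by (simp only: of_nat_Suc distrib_right mult_1_left add.commute)
    then have "real (Suc k) * (\<epsilon> ^ 4 * real (length (concat Ss))) \<le> (\<Sum>W\<leftarrow>Us. energy A W)"
      using Us(5) Ts(5) False unfolding Ts(1) by linarith
    then show ?thesis using Us(1-4) Ts(1-4) by (intro exI[of _ Us]) auto
  qed
qed

lemma regular_refinement:
  assumes "finite A" and "\<epsilon> > 0" and "1 \<le> real (Suc k) * \<epsilon> ^ 4"
  obtains Ts where "eps_regular_partition A \<epsilon> (concat Ss) Ts" and "[] \<notin> set Ss \<Longrightarrow> [] \<notin> set Ts"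
    and "length Ss \<le> length Ts" and "length Ts \<le> length Ss * 3 ^ k"
proof -
  let ?n = "real (length (concat Ss))"
  obtain Ts where Ts: "concat Ts = concat Ss" "length Ss \<le> length Ts"
    "length Ts \<le> length Ss * 3 ^ k" "[] \<notin> set Ss \<longrightarrow> [] \<notin> set Ts"
    "eps_regular_partition A \<epsilon> (concat Ss) Ts \<or>
     real k * (\<epsilon> ^ 4 * ?n) \<le> (\<Sum>W\<leftarrow>Ts. energy A W)"
    using regular_or_high_energy[OF assms(1,2)] by blast
  have "eps_regular_partition A \<epsilon> (concat Ss) Ts"
  proof (rule ccontr)
    assume irr: "\<not> eps_regular_partition A \<epsilon> (concat Ss) Ts"
    then have "\<not> eps_regular_partition A \<epsilon> (concat Ts) Ts" by (simp add: Ts(1))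
    from irregular_partition_refine[OF assms(1,2) this]
    obtain Us where Us: "concat Us = concat Ts"
      "(\<Sum>W\<leftarrow>Ts. energy A W) + \<epsilon> ^ 4 * real (length (concat Ts)) < (\<Sum>W\<leftarrow>Us. energy A W)"
      by blast
    have "?n \<le> (real (Suc k) * \<epsilon> ^ 4) * ?n"
      using mult_right_mono[OF assms(3), of ?n] by simp
    also have "\<dots> = real k * (\<epsilon> ^ 4 * ?n) + \<epsilon> ^ 4 * ?n"
      by (simp only: of_nat_Suc distrib_right mult_1_left add.commute mult.assoc)
    also have "\<dots> < (\<Sum>W\<leftarrow>Us. energy A W)"
      using Us(2) Ts(5) irr unfolding Ts(1) by linarith
    also have "\<dots> \<le> ?n"
      using sum_energy_le_length[OF assms(1), of Us] by (simp only: Us(1) Ts(1))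
    finally show False by simp
  qed
  with Ts that show ?thesis by blast
qed

lemma initial_partition:
  assumes "t > 0"
  obtains Ss where "concat Ss = S" and "length Ss = t" and "t \<le> length S \<Longrightarrow> [] \<notin> set Ss"
proof -
  define Ss where "Ss = map (\<lambda>a. [a]) (take (t - 1) S) @ [drop (t - 1) S]"
  define Ts where "Ts = (if t \<le> length S then Ss else S # replicate (t - 1) [])"
  have "concat (map (\<lambda>a. [a]) xs) = xs" for xs :: "'a list" by (induction xs) auto
  then have "concat Ts = S"
    by (simp add: Ts_def Ss_def)
  moreover have "length Ts = t" using assms by (auto simp: Ts_def Ss_def)
  moreover have "[] \<notin> set Ts" if "t \<le> length S" using that assms by (auto simp: Ts_def Ss_def)
  ultimately show ?thesis using that by blast
qed

theorem theorem4:
  fixes A :: "'a set" and \<epsilon> :: real and t0 :: nat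
  assumes "finite A" and "\<epsilon> > 0" and "t0 > 0"
  shows "\<exists>(n0::real) (T0::nat).
           real T0 \<le> real t0 * 3 powr (1 / \<epsilon> ^ 4) \<and>
           n0 = real t0 * \<epsilon> powr (- (1 / \<epsilon> ^ 4)) \<and>
           (\<forall>(n::nat). \<forall>S\<in>words A n. real n \<ge> n0 \<longrightarrow>
              (\<exists>Ss. eps_regular_partition A \<epsilon> S Ss \<and>
                    (t0 \<le> n \<longrightarrow> [] \<notin> set Ss) \<and>
                    t0 \<le> length Ss \<and> length Ss \<le> T0))"
proof -
  define k where "k = nat \<lfloor>1 / \<epsilon> ^ 4\<rfloor>"
  have "0 \<le> 1 / \<epsilon> ^ 4" by simp
  then have k: "real k \<le> 1 / \<epsilon> ^ 4" "1 / \<epsilon> ^ 4 < real (Suc k)"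
    unfolding k_def by linarith+
  have "1 < real (Suc k) * \<epsilon> ^ 4"
    using k(2) assms(2) by (simp only: pos_divide_less_eq[OF zero_less_power])
  then have "\<exists>Ss. eps_regular_partition A \<epsilon> S Ss \<and> (t0 \<le> n \<longrightarrow> [] \<notin> set Ss) \<and>
      t0 \<le> length Ss \<and> length Ss \<le> t0 * 3 ^ k" if "S \<in> words A n" for n S
  proof -
    obtain Ss where "concat Ss = S" "length Ss = t0" "t0 \<le> length S \<Longrightarrow> [] \<notin> set Ss"
      using initial_partition[OF assms(3)] by blast
    moreover have "length S = n" using that by (simp add: words_def)
    ultimately show ?thesis
      using regular_refinement[OF assms(1,2), of k Ss] \<open>1 < real (Suc k) * \<epsilon> ^ 4\<close>
      by (metis less_imp_le)
  qed
  moreover have "(3::real) ^ k \<le> 3 powr (1 / \<epsilon> ^ 4)"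
    using k(1) by (simp flip: powr_realpow)
  then have "real (t0 * 3 ^ k) \<le> real t0 * 3 powr (1 / \<epsilon> ^ 4)"
    by (simp add: mult_left_mono)
  ultimately show ?thesis by blast
qed

end
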